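(* Let $F$ be an algebraically closed field of characteristic $p>0$ and let $\tilde G$ be a non-trivial finite $p$-group. Then for every faithful $\tilde G$-module $V$ over $F$ we have \[ \delta(\tilde G,V)\ge \exp(Z(\tilde G))\ge p. \] If $\tilde G$ is an abelian $p$-group, we particularly have \[ \delta(\tilde G,V)\ge \exp(\tilde G)\ge p. \]
   Context: A $G$-module is a finite dimensional representation of a finite group $G$ over $F$. $G$ acts on the polynomial ring $F[V]$ by $\tau(f)=f\circ\tau^{-1}$; $F[V]^G_d$ is the space of homogeneous invariants of degree $d$; $V^G$ is the space of fixed points. For $v\in V\setminus\{0\}$ put $\epsilon(G,v)=\min\{d>0\mid \text{there is } f\in F[V]^G_d \text{ with } f(v)\ne 0\}$. The degree of reductivity $\delta(G,V)$ is defined to be $0$ if $V^G=\{0\}$, and otherwise the supremum of $\epsilon(G,v)$ over all $v\in V^G\setminus\{0\}$. $Z(G)$ is the center of $G$, and $\exp(G)$ is the exponent of $G$, i.e. the least common multiple of the orders of its elements. *)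

theory Defs
  imports
    "HOL-Computational_Algebra.Polynomial"
    "HOL-Algebra.Group_Action"
    "HOL-Algebra.Multiplicative_Group"
    "HOL-Library.Extended_Nat"
begin

definition center :: "('g, 'm) monoid_scheme \<Rightarrow> 'g set" where
  "center G = {z \<in> carrier G. \<forall>g \<in> carrier G. z \<otimes>\<^bsub>G\<^esub> g = g \<otimes>\<^bsub>G\<^esub> z}"

definition group_exponent :: "('g, 'm) monoid_scheme \<Rightarrow> nat" where
  "group_exponent G = Lcm (group.ord G ` carrier G)"

definition finite_p_group :: "nat \<Rightarrow> ('g, 'm) monoid_scheme \<Rightarrow> bool" where
  "finite_p_group p G \<longleftrightarrow> group G \<and> finite (carrier G) \<and> (\<exists>n. Coset.order G = p ^ n)"

text \<open>
  The module is the whole type \<open>'v\<close>, with scalar multiplication \<open>scale\<close>.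
  The representation \<open>\<rho>\<close> is a homomorphism into the group of all bijections of
  \<open>'v\<close> whose values are linear. It is faithful if \<open>faithful_action G UNIV \<rho>\<close> holds.
\<close>

locale G_module = group_action G "UNIV :: 'v set" \<rho> + vector_space scale
  for G :: "('g, 'm) monoid_scheme" (structure)
    and scale :: "'f::field \<Rightarrow> 'v::ab_group_add \<Rightarrow> 'v"
    and \<rho> :: "'g \<Rightarrow> 'v \<Rightarrow> 'v" +
  assumes finite_group: "finite (carrier G)"
    and finite_dim: "\<exists>B. finite B \<and> span B = UNIV"
    and linear_rep: "g \<in> carrier G \<Longrightarrow> Vector_Spaces.linear scale scale (\<rho> g)"

text \<open>
  Homogeneous elements of degree \<open>d\<close> of the polynomial ring \<open>F[V] = S(V\<^sup>*)\<close>: linear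
  combinations of products of \<open>d\<close> linear forms. They are represented as functions on
  \<open>V\<close>, which loses nothing over an infinite field, in particular over an algebraically
  closed one. The zero polynomial (\<open>n = 0\<close>) is homogeneous of every degree.
\<close>

definition homogeneous_poly ::
    "('f::field \<Rightarrow> 'v::ab_group_add \<Rightarrow> 'v) \<Rightarrow> nat \<Rightarrow> ('v \<Rightarrow> 'f) \<Rightarrow> bool" where
  "homogeneous_poly scale d f \<longleftrightarrow>
     (\<exists>(n::nat) (c :: nat \<Rightarrow> 'f) (l :: nat \<Rightarrow> nat \<Rightarrow> 'v \<Rightarrow> 'f).
        (\<forall>i<n. \<forall>j<d. Vector_Spaces.linear scale (*) (l i j)) \<and>
        f = (\<lambda>v. \<Sum>i<n. c i * (\<Prod>j<d. l i j v)))"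

definition poly_action ::
    "('g, 'm) monoid_scheme \<Rightarrow> ('g \<Rightarrow> 'v \<Rightarrow> 'v) \<Rightarrow> 'g \<Rightarrow> ('v \<Rightarrow> 'f) \<Rightarrow> 'v \<Rightarrow> 'f" where
  "poly_action G \<rho> g f = f \<circ> \<rho> (inv\<^bsub>G\<^esub> g)"

definition homogeneous_invariants ::
    "('g, 'm) monoid_scheme \<Rightarrow> ('f::field \<Rightarrow> 'v::ab_group_add \<Rightarrow> 'v) \<Rightarrow> ('g \<Rightarrow> 'v \<Rightarrow> 'v)
      \<Rightarrow> nat \<Rightarrow> ('v \<Rightarrow> 'f) set" where
  "homogeneous_invariants G scale \<rho> d =
     {f. homogeneous_poly scale d f \<and> (\<forall>g \<in> carrier G. poly_action G \<rho> g f = f)}"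

definition fixed_points ::
    "('g, 'm) monoid_scheme \<Rightarrow> ('g \<Rightarrow> 'v \<Rightarrow> 'v) \<Rightarrow> 'v set" where
  "fixed_points G \<rho> = {v. \<forall>g \<in> carrier G. \<rho> g v = v}"

text \<open>
  Degrees are taken in \<^typ>\<open>enat\<close> so that infimum and supremum are meaningful without side
  conditions. For a finite group and a fixed point \<open>v \<noteq> 0\<close> the infimum is over a nonempty
  set and hence a minimum: the product of the translates of a linear form not vanishing at
  \<open>v\<close> is an invariant of degree \<open>|G|\<close> not vanishing at \<open>v\<close>.
\<close>

definition \<epsilon> ::
    "('g, 'm) monoid_scheme \<Rightarrow> ('f::field \<Rightarrow> 'v::ab_group_add \<Rightarrow> 'v) \<Rightarrow> ('g \<Rightarrow> 'v \<Rightarrow> 'v)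
      \<Rightarrow> 'v \<Rightarrow> enat" where
  "\<epsilon> G scale \<rho> v =
     Inf (enat ` {d. d > 0 \<and> (\<exists>f \<in> homogeneous_invariants G scale \<rho> d. f v \<noteq> 0)})"

definition \<delta> ::
    "('g, 'm) monoid_scheme \<Rightarrow> ('f::field \<Rightarrow> 'v::ab_group_add \<Rightarrow> 'v) \<Rightarrow> ('g \<Rightarrow> 'v \<Rightarrow> 'v)
      \<Rightarrow> enat" where
  "\<delta> G scale \<rho> =
     (if fixed_points G \<rho> = {0} then 0
      else Sup (\<epsilon> G scale \<rho> ` (fixed_points G \<rho> - {0})))"

end

theory Submission
  imports Defs
begin

text \<open>
  Let \<open>z \<in> Z(G)\<close> have order \<open>p\<^sup>k = exp (Z(G))\<close>, where \<open>k = r + 1\<close>. The subspace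
  \<open>(z\<^bsup>p^r\<^esup> - 1) V\<close> is nonzero and \<open>G\<close>-stable, hence contains a fixed point
  \<open>v = (z\<^bsup>p^r\<^esup> - 1) u \<noteq> 0\<close>. Every homogeneous invariant \<open>f\<close> with \<open>f(v) \<noteq> 0\<close> has degree
  divisible by \<open>p\<^sup>k\<close>: by descending induction on \<open>j\<close>, the polynomial \<open>f(w + t v)\<close> in \<open>t\<close> is a
  polynomial in \<open>t\<^bsup>p^(k-j)\<^esup>\<close> whenever \<open>z\<^bsup>p^j\<^esup>\<close> fixes \<open>w\<close>. For the step pick \<open>y\<close> with
  \<open>z\<^bsup>p^j\<^esup> y = y + v\<close>; then \<open>f(w + s y + t v)\<close> is invariant under \<open>t \<mapsto> t + s\<close>, and the
  lowest-order term in \<open>s\<close> of this identity gains one factor \<open>p\<close> in the exponents at \<open>s = 0\<close>.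
  With \<open>j = 0\<close> and \<open>w = 0\<close> this is a statement about \<open>f(t v) = t\<^sup>d f(v)\<close>.
\<close>

hide_const (open) UnivPoly.monom UnivPoly.coeff Module.smult

section \<open>Shift-invariant polynomials in characteristic p\<close>

text \<open>In a finite field, 1 plus the product of all \<open>X - a\<close> would have positive
  degree and yet take the value 1 everywhere.\<close>

lemma infinite_UNIV_alg_closed: "infinite (UNIV :: 'a::alg_closed_field set)"
proof
  assume fin: "finite (UNIV :: 'a set)"
  define q :: "'a poly" where "q = (\<Prod>a\<in>UNIV. [:- a, 1:]) + 1"
  have "degree (\<Prod>a\<in>(UNIV::'a set). [:- a, 1:]) = card (UNIV :: 'a set)"
    by (subst degree_prod_eq_sum_degree) auto
  moreover have "card (UNIV :: 'a set) > 0"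
    using fin by (simp add: card_gt_0_iff)
  ultimately have "degree q > 0"
    unfolding q_def by (metis degree_1 degree_add_eq_left)
  then obtain x where "poly q x = 0"
    using alg_closed_imp_poly_has_root by blast
  moreover have "poly (\<Prod>a\<in>UNIV. [:- a, 1:]) x = 0"
    using fin by (simp add: poly_prod)
  ultimately show False
    by (simp add: q_def)
qed

lemma poly_eqI_infinite:
  fixes p q :: "'a::idom poly"
  assumes "infinite (UNIV :: 'a set)" and "\<And>x. poly p x = poly q x"
  shows "p = q"
proof (rule ccontr)
  assume "p \<noteq> q"
  then have "finite {x. poly (p - q) x = 0}"
    by (intro poly_roots_finite) simp
  with assms show False
    by simp
qed

text \<open>Evaluation at \<open>s\<close> is a ring homomorphism, so of the inner polynomial
  \<open>c\<close> only its value at \<open>s\<close> survives. This allows substituting a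
  nonconstant \<open>c\<close> for the outer variable.\<close>

lemma poly_poly_eq_poly_poly_const:
  "poly (poly Q c) s = poly (poly Q [:poly c s:]) s"
  by (induction Q) auto

lemma poly_poly_const: "poly (poly Q [:t:]) s = poly (map_poly (\<lambda>q. poly q s) Q) t"
  by (induction Q) (auto simp: map_poly_pCons)

lemma poly_poly_eqI_infinite:
  fixes P Q :: "'a::idom poly poly"
  assumes inf: "infinite (UNIV :: 'a set)"
    and eq: "\<And>s t. poly (poly P [:t:]) s = poly (poly Q [:t:]) s"
  shows "P = Q"
proof (rule poly_eqI)
  fix i
  have "map_poly (\<lambda>q. poly q s) P = map_poly (\<lambda>q. poly q s) Q" for s
    using eq by (intro poly_eqI_infinite[OF inf]) (simp add: poly_poly_const)
  then have "poly (coeff P i) s = poly (coeff Q i) s" for s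
    by (metis (no_types, lifting) coeff_map_poly poly_0)
  then show "coeff P i = coeff Q i"
    by (rule poly_eqI_infinite[OF inf])
qed

text \<open>Being a polynomial in the \<open>e\<close>-th power of the variable becomes a condition
  on single coefficients. It is used over the field and over \<open>'a poly\<close> alike.\<close>

lemma pcompose_monom_iff:
  fixes P :: "'a::comm_ring_1 poly"
  assumes "e > 0"
  shows "(\<exists>Q. P = pcompose Q (monom 1 e)) \<longleftrightarrow> (\<forall>i. \<not> e dvd i \<longrightarrow> coeff P i = 0)"
proof
  have sumform: "pcompose Q (monom 1 e) = (\<Sum>m\<le>degree Q. monom (coeff Q m) (e * m))" for Q :: "'a poly"
    by (simp add: pcompose_altdef poly_altdef degree_map_poly coeff_map_poly monom_power smult_monom)
  {
    assume "\<exists>Q. P = pcompose Q (monom 1 e)"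
    then show "\<forall>i. \<not> e dvd i \<longrightarrow> coeff P i = 0"
      by (auto simp: sumform coeff_sum intro!: sum.neutral)
  next
    assume supp: "\<forall>i. \<not> e dvd i \<longrightarrow> coeff P i = 0"
    define Q where "Q = Abs_poly (\<lambda>m. coeff P (e * m))"
    \<comment> \<open>Since \<open>i \<le> e * i\<close>, the coefficient sequence given to
      \<open>Abs_poly\<close> is eventually zero.\<close>
    have "coeff P (e * i) = 0" if "i > degree P" for i
    proof -
      have "i \<le> e * i" using assms by simp
      with that show ?thesis by (intro coeff_eq_0) (rule less_le_trans)
    qed
    then have coeff_Q: "coeff Q m = coeff P (e * m)" for m
      unfolding Q_def by (subst coeff_Abs_poly[where n = "degree P"]) auto
    have "P = pcompose Q (monom 1 e)"
    proof (rule poly_eqI)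
      fix i
      show "coeff P i = coeff (pcompose Q (monom 1 e)) i"
      proof (cases "e dvd i")
        case True
        then obtain m where i: "i = e * m" ..
        have "coeff (pcompose Q (monom 1 e)) i = (\<Sum>m'\<le>degree Q. if m' = m then coeff Q m' else 0)"
          using assms by (auto simp: sumform coeff_sum i intro!: sum.cong)
        also have "\<dots> = coeff Q m"
          by (auto simp: coeff_eq_0)
        finally show ?thesis by (simp add: coeff_Q i)
      next
        case False
        then show ?thesis using supp
          by (auto simp: sumform coeff_sum intro!: sum.neutral)
      qed
    qed
    then show "\<exists>Q. P = pcompose Q (monom 1 e)" ..
  }
qed

text \<open>First-order Taylor formula; the remainder stays an unspecified multiple of
  \<open>h^2\<close>, so no factorial is inverted and positive characteristic is harmless.\<close>

lemma pcompose_shift_expansion: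
  fixes Q :: "'a::idom poly"
  shows "\<exists>X. pcompose Q [:h, 1:] = Q + smult h (pderiv Q) + smult (h\<^sup>2) X"
proof (induction Q)
  case 0
  then show ?case by (intro exI[of _ 0]) simp
next
  case (pCons a Q)
  then obtain X where X: "pcompose Q [:h, 1:] = Q + smult h (pderiv Q) + smult (h\<^sup>2) X"
    by blast
  show ?case
    \<comment> \<open>Multiply the expansion of \<open>Q\<close> by \<open>[:h, 1:]\<close> and
      collect the terms carrying \<open>h^2\<close>.\<close>
    by (rule exI[of _ "pderiv Q + [:h, 1:] * X"])
      (simp add: pcompose_pCons X pderiv_pCons algebra_simps power2_eq_square smult_add_right)
qed

text \<open>
  \<open>R\<close> is a polynomial in \<open>t\<close> whose coefficients are polynomials in \<open>s\<close>.
\<close>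

lemma poly_in_power_CHAR_if_shift_invariant:
  fixes R :: "'a::alg_closed_field poly poly"
  assumes p: "prime CHAR('a)" and e: "e = CHAR('a) ^ n"
    and pow: "\<And>s. \<exists>Q. \<forall>t. poly (poly R [:t:]) s = poly Q (t ^ e)"
    and shift: "\<And>s t. poly (poly R [:t + s:]) s = poly (poly R [:t:]) s"
  shows "\<exists>Q. \<forall>t. poly (poly R [:t:]) 0 = poly Q (t ^ (e * CHAR('a)))"
proof -
  note inf = infinite_UNIV_alg_closed[where 'a='a]
  have e0: "e > 0" using p e by (simp add: prime_gt_0_nat)
  \<comment> \<open>Each coefficient of \<open>R\<close> is a polynomial in \<open>s\<close>. The
    hypothesis at the single values of \<open>s\<close> makes it vanish everywhere, so one
    \<open>Q\<close> over \<open>'a poly\<close> serves all \<open>s\<close>.\<close>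
  have "coeff R i = 0" if "\<not> e dvd i" for i
  proof (rule poly_eqI_infinite[OF inf])
    fix s
    obtain Q where Q: "\<And>t. poly (poly R [:t:]) s = poly Q (t ^ e)" using pow by blast
    have "map_poly (\<lambda>q. poly q s) R = pcompose Q (monom 1 e)"
      by (rule poly_eqI_infinite[OF inf]) (simp add: poly_poly_const [symmetric] Q poly_pcompose poly_monom)
    then have "coeff (map_poly (\<lambda>q. poly q s) R) i = 0"
      using pcompose_monom_iff[OF e0] that by blast
    then show "poly (coeff R i) s = poly 0 s"
      by (simp add: coeff_map_poly)
  qed
  then obtain Q where R: "R = pcompose Q (monom 1 e)"
    using pcompose_monom_iff[OF e0, of R] by blast
  have RQ: "poly (poly R [:t:]) s = poly (poly Q [:t ^ e:]) s" for s t
    by (simp add: R poly_pcompose poly_monom poly_const_pow)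
  \<comment> \<open>\<open>h\<close> is \<open>s^e\<close>. As \<open>(t + s)^e = t^e + s^e\<close>
    in characteristic p, in terms of \<open>T = t^e\<close> the shift becomes
    \<open>T \<mapsto> T + h\<close>.\<close>
  define h :: "'a poly" where "h = monom 1 e"
  have "pcompose Q [:h, 1:] = Q"
  proof (rule poly_poly_eqI_infinite[OF inf])
    fix s T :: 'a
    obtain t where t: "t ^ e = T" using nth_root_exists[OF e0, of T] by blast
    have "poly (poly (pcompose Q [:h, 1:]) [:T:]) s = poly (poly Q [:T + s ^ e:]) s"
      using poly_poly_eq_poly_poly_const[of Q "[:T:] + h" s]
      by (simp add: poly_pcompose h_def poly_monom add.commute)
    also have "T + s ^ e = (t + s) ^ e"
      by (simp add: t freshmans_dream'[OF p e])
    also have "poly (poly Q [:(t + s) ^ e:]) s = poly (poly Q [:t ^ e:]) s"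
      using shift[of t s] by (simp only: RQ)
    finally show "poly (poly (pcompose Q [:h, 1:]) [:T:]) s = poly (poly Q [:T:]) s"
      by (simp add: t)
  qed
  moreover obtain X where "pcompose Q [:h, 1:] = Q + smult h (pderiv Q) + smult (h\<^sup>2) X"
    using pcompose_shift_expansion by blast
  \<comment> \<open>Subtracting \<open>Q\<close> and cancelling \<open>h\<close> makes
    \<open>pderiv Q\<close> a multiple of \<open>h\<close>, hence zero at
    \<open>s = 0\<close>.\<close>
  ultimately have "smult h (pderiv Q + smult h X) = 0"
    by (simp add: smult_add_right power2_eq_square add.assoc)
  moreover have "h \<noteq> 0" by (simp add: h_def)
  ultimately have "pderiv Q + smult h X = 0" by simp
  then have "pderiv Q = - smult h X" by (simp add: eq_neg_iff_add_eq_0)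
  then have "poly (coeff (pderiv Q) i) 0 = 0" for i
    using e0 by (simp add: h_def poly_monom)
  then have deriv: "of_nat (Suc i) * poly (coeff Q (Suc i)) 0 = 0" for i
    by (simp add: coeff_pderiv)
  \<comment> \<open>At \<open>s = 0\<close> the derivative vanishes, so only exponents divisible by
    the characteristic remain; this supplies the extra factor.\<close>
  define Q0 where "Q0 = map_poly (\<lambda>q. poly q 0) Q"
  have "coeff Q0 i = 0" if "\<not> CHAR('a) dvd i" for i
  proof -
    obtain j where "i = Suc j" using \<open>\<not> CHAR('a) dvd i\<close> by (cases i) auto
    moreover have "of_nat i \<noteq> (0 :: 'a)" using that by (simp add: of_nat_eq_0_iff_char_dvd)
    ultimately show ?thesis using deriv[of j]
      by (auto simp: Q0_def coeff_map_poly simp del: of_nat_Suc)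
  qed
  then obtain Q1 where Q1: "Q0 = pcompose Q1 (monom 1 CHAR('a))"
    using pcompose_monom_iff[of "CHAR('a)" Q0] prime_gt_0_nat[OF p] by blast
  have "poly (poly R [:t:]) 0 = poly Q1 (t ^ (e * CHAR('a)))" for t
  proof -
    have "poly (poly R [:t:]) 0 = poly Q0 (t ^ e)"
      unfolding Q0_def poly_poly_const [symmetric] by (rule RQ)
    then show ?thesis by (simp add: Q1 poly_pcompose poly_monom power_mult)
  qed
  then show ?thesis by blast
qed

section \<open>Finite p-groups\<close>

text \<open>\<open>restrict\<close> appears because elements of \<open>BijGroup\<close> are
  extensional. Surjectivity on \<open>X\<close> comes from stability under
  \<open>inv g\<close>.\<close>

lemma (in group_action) restrict_invariant_subset:
  assumes X: "X \<subseteq> E" and stable: "\<And>g x. g \<in> carrier G \<Longrightarrow> x \<in> X \<Longrightarrow> \<phi> g x \<in> X"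
  shows "group_action G X (\<lambda>g. restrict (\<phi> g) X)"
proof -
  interpret group G
    using group_hom by (simp add: group_hom_def)
  have Bij: "restrict (\<phi> g) X \<in> Bij X" if g: "g \<in> carrier G" for g
  proof -
    have "inj_on (\<phi> g) X"
      using inj_prop[OF g] X by (rule inj_on_subset)
    moreover have "y \<in> \<phi> g ` X" if y: "y \<in> X" for y
    proof (rule image_eqI)
      show "\<phi> (inv g) y \<in> X"
        using g y by (simp add: stable)
      have "y \<in> E" using X y by blast
      then have "\<phi> g (\<phi> (inv g) y) = \<phi> \<one> y"
        using g by (metis composition_rule inv_closed r_inv)
      with \<open>y \<in> E\<close> show "y = \<phi> g (\<phi> (inv g) y)"
        by (simp add: id_eq_one[symmetric])
    qed
    ultimately show ?thesis
      using stable[OF g] by (auto simp: Bij_def bij_betw_def inj_on_def)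
  qed
  have "restrict (\<phi> (g \<otimes> h)) X = compose X (restrict (\<phi> g) X) (restrict (\<phi> h) X)"
    if "g \<in> carrier G" "h \<in> carrier G" for g h
    using that X stable by (auto simp: compose_def fun_eq_iff composition_rule subset_iff)
  with Bij have "(\<lambda>g. restrict (\<phi> g) X) \<in> hom G (BijGroup X)"
    by (auto simp: hom_def BijGroup_def)
  then show ?thesis
    by (simp add: group_action_def group_hom_def group_hom_axioms_def group_BijGroup is_group)
qed

text \<open>Every orbit that is not a singleton has size a power of \<open>p\<close> greater than 1,
  and these orbits partition the complement of the fixed points.\<close>

lemma (in group_action) prime_dvd_card_fixed_points:
  assumes p: "prime p" and ord: "order G = p ^ n" and fin: "finite E" and dvd: "p dvd card E"
  shows "p dvd card {x \<in> E. \<forall>g \<in> carrier G. \<phi> g x = x}"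
proof -
  interpret group G
    using group_hom by (simp add: group_hom_def)
  define F where "F = {x \<in> E. \<forall>g \<in> carrier G. \<phi> g x = x}"
  define C where "C = {orb \<in> orbits G E \<phi>. card orb \<noteq> 1}"
  have "\<Union> C = E - F"
  proof (intro equalityI subsetI)
    fix x assume "x \<in> \<Union> C"
    then obtain orb where orb: "orb \<in> orbits G E \<phi>" "card orb \<noteq> 1" "x \<in> orb"
      by (auto simp: C_def)
    then have x: "x \<in> E"
      using orbits_coverture by blast
    then have "orbit G \<phi> x \<in> orbits G E \<phi>" "x \<in> orbit G \<phi> x"
      by (auto simp: orbits_def orbit_refl)
    with orb have "orb = orbit G \<phi> x"
      using disjoint_union by blast
    moreover have "orbit G \<phi> x = {x}" if "x \<in> F"
      using that orbit_refl[OF x] by (auto simp: F_def orbit_def)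
    ultimately show "x \<in> E - F" using orb x by auto
  next
    fix x assume x: "x \<in> E - F"
    then obtain g where g: "g \<in> carrier G" "\<phi> g x \<noteq> x"
      by (auto simp: F_def)
    have *: "x \<in> orbit G \<phi> x" "\<phi> g x \<in> orbit G \<phi> x"
      using x g by (auto simp: orbit_refl) (auto simp: orbit_def)
    with g have "card (orbit G \<phi> x) \<noteq> 1"
      by (metis card_1_singletonE singletonD)
    with x * show "x \<in> \<Union> C"
      by (auto simp: C_def orbits_def)
  qed
  moreover have "p dvd card orb" if orb: "orb \<in> C" for orb
  proof -
    obtain x where "x \<in> E" "orb = orbit G \<phi> x"
      using orb by (auto simp: C_def orbits_def)
    then have "card orb dvd p ^ n"
      using orbit_stabilizer_theorem[of x] ord by (metis dvd_triv_left)
    then obtain k where "card orb = p ^ k"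
      using p by (auto simp: divides_primepow_nat)
    with orb show ?thesis
      by (cases k) (auto simp: C_def)
  qed
  moreover have "pairwise disjnt C"
    using disjoint_union by (fastforce simp: C_def pairwise_def disjnt_def)
  ultimately have "p dvd card (E - F)"
    using dvd_partition[of C p] fin by (auto simp: pairwise_def disjnt_def)
  moreover have "card E = card (E - F) + card F"
    using fin card_Diff_subset[of F E] card_mono[of E F] by (simp add: F_def)
  ultimately show ?thesis
    using dvd by (simp add: F_def [symmetric] dvd_add_right_iff)
qed

section \<open>Center and exponent of a p-group\<close>

lemma (in group) center_subgroup: "subgroup (center G) G"
proof
  fix x assume "x \<in> center G"
  then have x: "x \<in> carrier G" and xc: "\<And>g. g \<in> carrier G \<Longrightarrow> x \<otimes> g = g \<otimes> x"
    by (auto simp: center_def)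
  have "inv x \<otimes> g = g \<otimes> inv x" if g: "g \<in> carrier G" for g
  proof -
    have "inv x \<otimes> g = inv x \<otimes> (g \<otimes> x) \<otimes> inv x"
      using x g by (simp add: m_assoc)
    also have "\<dots> = inv x \<otimes> (x \<otimes> g) \<otimes> inv x"
      using xc[OF g] by simp
    also have "\<dots> = g \<otimes> inv x"
      using x g by (simp add: m_assoc[symmetric])
    finally show ?thesis .
  qed
  with x show "inv x \<in> center G"
    by (simp add: center_def)
  fix y assume "y \<in> center G"
  then have y: "y \<in> carrier G" and yc: "\<And>g. g \<in> carrier G \<Longrightarrow> y \<otimes> g = g \<otimes> y"
    by (auto simp: center_def)
  have "x \<otimes> y \<otimes> g = g \<otimes> (x \<otimes> y)" if g: "g \<in> carrier G" for g
  proof -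
    have "x \<otimes> y \<otimes> g = x \<otimes> (g \<otimes> y)"
      using x y g yc[OF g] by (simp add: m_assoc)
    also have "\<dots> = g \<otimes> x \<otimes> y"
      using x y g xc[OF g] by (simp flip: m_assoc)
    finally show ?thesis
      using x y g by (simp add: m_assoc)
  qed
  with x y show "x \<otimes> y \<in> center G"
    by (simp add: center_def)
qed (auto simp: center_def)

text \<open>The center is the fixed-point set of conjugation, so \<open>p\<close> divides its
  size.\<close>

lemma (in group) p_group_center_nontrivial:
  assumes p: "prime p" and ord: "order G = p ^ n" and nontriv: "carrier G \<noteq> {\<one>}"
  shows "center G \<noteq> {\<one>}"
proof
  assume trivial: "center G = {\<one>}"
  interpret conj: group_action G "carrier G" "\<lambda>g. \<lambda>h \<in> carrier G. g \<otimes> h \<otimes> inv g"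
    by (rule action_by_conjugation)
  have "{x \<in> carrier G. \<forall>g \<in> carrier G. (\<lambda>h \<in> carrier G. g \<otimes> h \<otimes> inv g) x = x} = center G"
    by (auto simp: center_def) (metis inv_solve_right m_closed)+
  moreover have fin: "finite (carrier G)"
    using ord p by (metis order_gt_0_iff_finite prime_gt_0_nat zero_less_power)
  moreover have "n \<noteq> 0"
    using ord nontriv by (metis order_one_triv_iff power_0)
  then have "p dvd card (carrier G)"
    using ord by (simp add: order_def)
  ultimately have "p dvd card (center G)"
    using conj.prime_dvd_card_fixed_points[OF p ord] by simp
  with trivial p show False
    by (simp add: prime_nat_iff)
qed

text \<open>All orders are powers of \<open>p\<close> and form a chain under divisibility, so their
  least common multiple is the largest of them.\<close>

lemma (in group) p_group_exponent_attained:
  assumes p: "prime p" and ord: "order G = p ^ n"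
  shows "\<exists>z \<in> carrier G. group_exponent G = ord z"
proof -
  have fin: "finite (carrier G)"
    using ord p by (metis order_gt_0_iff_finite prime_gt_0_nat zero_less_power)
  define M where "M = Max (ord ` carrier G)"
  have "M \<in> ord ` carrier G"
    unfolding M_def using fin by (intro Max_in) auto
  then obtain z where z: "z \<in> carrier G" "ord z = M" by auto
  have "ord x dvd ord z" if x: "x \<in> carrier G" for x
  proof -
    obtain i j where ij: "ord x = p ^ i" "ord z = p ^ j"
      using ord_dvd_group_order[OF x] ord_dvd_group_order[OF z(1)] p ord
      by (auto simp: divides_primepow_nat)
    moreover have "ord x \<le> ord z"
      using fin x z(2) by (simp add: M_def)
    ultimately have "i \<le> j"
      using prime_gt_1_nat[OF p] by simp
    with ij show ?thesis by (simp add: le_imp_power_dvd)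
  qed
  then have "group_exponent G = ord z"
    unfolding group_exponent_def using z
    by (intro dvd_antisym Lcm_least dvd_Lcm) auto
  with z show ?thesis by blast
qed

section \<open>Modules of finite p-groups\<close>

lemma homogeneous_poly_scale:
  assumes f: "homogeneous_poly scale d f"
  shows "f (scale t v) = t ^ d * f v"
proof -
  obtain n :: nat and c l where l: "\<forall>i<n. \<forall>j<d. Vector_Spaces.linear scale (*) (l i j)"
    and f: "f = (\<lambda>v. \<Sum>i<n. c i * (\<Prod>j<d. l i j v))"
    using assms unfolding homogeneous_poly_def by auto
  have "l i j (scale t v) = t * l i j v" if "i < n" "j < d" for i j
    using l that by (simp add: Vector_Spaces.linear_iff_module_hom module_hom.scale)
  then show ?thesis
    by (simp add: f prod.distrib sum_distrib_left mult.left_commute)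
qed

text \<open>Each linear form becomes an affine function of \<open>s\<close> and \<open>t\<close>.
  The inner variable of \<open>R\<close> is \<open>s\<close>, the outer one is
  \<open>t\<close>.\<close>

lemma homogeneous_poly_on_plane:
  assumes f: "homogeneous_poly scale d f"
  shows "\<exists>R. \<forall>s t. f (a + scale s b + scale t c) = poly (poly R [:t:]) s"
proof -
  obtain n :: nat and k l where l: "\<forall>i<n. \<forall>j<d. Vector_Spaces.linear scale (*) (l i j)"
    and f: "f = (\<lambda>v. \<Sum>i<n. k i * (\<Prod>j<d. l i j v))"
    using assms unfolding homogeneous_poly_def by auto
  define R where "R = (\<Sum>i<n. [:[:k i:]:] * (\<Prod>j<d. [:[:l i j a, l i j b:], [:l i j c:]:]))"
  have "l i j (a + scale s b + scale t c) = l i j a + s * l i j b + t * l i j c"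
    if "i < n" "j < d" for i j s t
  proof -
    have "module_hom scale (*) (l i j)"
      using l that by (simp add: Vector_Spaces.linear_iff_module_hom)
    then show ?thesis
      by (simp add: module_hom.add[where ?s1.0 = scale and ?s2.0 = "(*)"] module_hom.scale)
  qed
  then have "f (a + scale s b + scale t c) = poly (poly R [:t:]) s" for s t
    by (simp add: f R_def poly_sum poly_prod algebra_simps)
  then show ?thesis by blast
qed

context G_module
begin

sublocale group G
  using group_hom by (simp add: group_hom_def)

lemma rho_mult: "g \<in> carrier G \<Longrightarrow> h \<in> carrier G \<Longrightarrow> \<rho> (g \<otimes> h) v = \<rho> g (\<rho> h v)"
  by (simp add: composition_rule)

lemma rho_one [simp]: "\<rho> \<one> v = v"
  by (simp add: id_eq_one[symmetric])

lemma module_hom_rho: "g \<in> carrier G \<Longrightarrow> module_hom scale scale (\<rho> g)"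
  using linear_rep by (simp add: Vector_Spaces.linear_iff_module_hom)

lemmas rho_add = module_hom.add[OF module_hom_rho]
  and rho_diff = module_hom.diff[OF module_hom_rho]
  and rho_scale = module_hom.scale[OF module_hom_rho]
  and rho_sum = module_hom.sum[OF module_hom_rho]
  and rho_zero = module_hom.zero[OF module_hom_rho]

lemma homogeneous_invariantsD:
  assumes "f \<in> homogeneous_invariants G scale \<rho> d"
  shows "homogeneous_poly scale d f" and "g \<in> carrier G \<Longrightarrow> f (\<rho> g v) = f v"
proof -
  show "homogeneous_poly scale d f"
    using assms by (simp add: homogeneous_invariants_def)
  assume g: "g \<in> carrier G"
  then have "poly_action G \<rho> (inv g) f v = f v"
    using assms by (simp add: homogeneous_invariants_def)
  with g show "f (\<rho> g v) = f v"
    by (simp add: poly_action_def)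
qed

text \<open>Fixed points are counted in a finite additive subgroup of \<open>S\<close>: 0 is one of
  them and their number is divisible by \<open>p\<close>, so there is another.\<close>

lemma fixed_point_in_stable_subspace:
  assumes p: "prime p" and char: "CHAR('f) = p" and ord: "order G = p ^ n"
    and S: "subspace S" and stable: "\<And>g x. g \<in> carrier G \<Longrightarrow> x \<in> S \<Longrightarrow> \<rho> g x \<in> S"
    and w: "w \<in> S" "w \<noteq> 0"
  shows "\<exists>v \<in> S. v \<noteq> 0 \<and> v \<in> fixed_points G \<rho>"
proof -
  \<comment> \<open>The span of the orbit of \<open>w\<close> over the prime field is a finite \<open>p\<close>-group on which \<open>G\<close> acts.\<close>
  define comb where "comb c = (\<Sum>h\<in>carrier G. scale (of_nat (c h)) (\<rho> h w))" for c :: "'g \<Rightarrow> nat"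
  define X where "X = range comb"
  \<comment> \<open>Natural numbers stand for elements of the prime field: \<open>comb\<close>
    depends on its coefficients only modulo \<open>p\<close>, which makes \<open>X\<close>
    finite.\<close>
  have "(of_nat (k mod p) :: 'f) = of_nat k" for k
    using char by (metis add.right_neutral mod_mult_div_eq mult_zero_left of_nat_CHAR of_nat_add of_nat_mult)
  then have comb_mod: "comb (\<lambda>h. c h mod p) = comb c" for c
    by (simp add: comb_def)
  have "X \<subseteq> comb ` (carrier G \<rightarrow>\<^sub>E {..<p})"
  proof
    fix x assume "x \<in> X"
    then obtain c where "x = comb c" by (auto simp: X_def)
    also have "\<dots> = comb (restrict (\<lambda>h. c h mod p) (carrier G))"
      by (subst comb_mod [symmetric]) (simp add: comb_def)
    finally show "x \<in> comb ` (carrier G \<rightarrow>\<^sub>E {..<p})"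
      using prime_gt_0_nat[OF p] by auto
  qed
  then have fin: "finite X"
    by (rule finite_subset) (auto intro!: finite_PiE finite_group)
  have XS: "X \<subseteq> S"
    using S stable w by (auto simp: X_def comb_def intro!: subspace_sum subspace_scale)
  have comb_add: "comb c + comb c' = comb (\<lambda>h. c h + c' h)" for c c'
    by (simp add: comb_def sum.distrib scale_left_distrib)
  have comb_scale: "scale (of_nat k) (comb c) = comb (\<lambda>h. k * c h)" for k c
    by (simp add: comb_def scale_sum_right)
  have "comb (\<lambda>_. 0) = 0"
    by (simp add: comb_def)
  then have X0: "0 \<in> X"
    unfolding X_def by (metis rangeI)
  have "comb (\<lambda>h. if h = \<one> then 1 else 0) = w"
    using finite_group by (simp add: comb_def if_distrib[of of_nat] if_distrib[of "\<lambda>c. scale c _"] sum.delta cong: if_cong)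
  then have wX: "w \<in> X"
    unfolding X_def by (metis rangeI)
  have rho_comb: "\<rho> g (comb c) = comb (\<lambda>h. c (inv g \<otimes> h))" if g: "g \<in> carrier G" for g c
  proof -
    have "\<rho> g (comb c) = (\<Sum>h\<in>carrier G. scale (of_nat (c h)) (\<rho> (g \<otimes> h) w))"
      using g by (simp add: comb_def rho_sum rho_scale rho_mult)
    also have "\<dots> = comb (\<lambda>h. c (inv g \<otimes> h))"
      unfolding comb_def
      by (rule sum.reindex_bij_witness[of _ "\<lambda>h. inv g \<otimes> h" "\<lambda>h. g \<otimes> h"])
        (use g in \<open>auto simp flip: m_assoc\<close>)
    finally show ?thesis .
  qed
  \<comment> \<open>\<open>X\<close> as an additive group: by Lagrange, the element \<open>w\<close>
    of order \<open>p\<close> gives \<open>p dvd card X\<close>.\<close>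
  define A where "A = \<lparr>carrier = X, mult = (+), one = 0 :: 'v\<rparr>"
  have scale_p: "scale (of_nat p) x = 0" for x
    using char by (metis of_nat_CHAR scale_zero_left)
  have "group A"
  proof (rule groupI)
    fix x assume "x \<in> carrier A"
    then obtain c where c: "x = comb c" by (auto simp: A_def X_def)
    \<comment> \<open>The multiple of \<open>x\<close> by \<open>p - 1\<close> serves as its
      negative, since the coefficients in \<open>comb\<close> are natural numbers.\<close>
    have "scale (of_nat (p - 1)) x + x = scale (of_nat p) x"
      using prime_gt_0_nat[OF p] by (cases p) (auto simp: scale_left_distrib)
    moreover have "scale (of_nat (p - 1)) x \<in> X"
      unfolding c comb_scale by (simp add: X_def)
    ultimately show "\<exists>y\<in>carrier A. y \<otimes>\<^bsub>A\<^esub> x = \<one>\<^bsub>A\<^esub>"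
      by (auto simp: A_def scale_p)
  qed (auto simp: A_def X0 add.assoc, auto simp: X_def comb_add)
  then interpret A: group A .
  have pow: "x [^]\<^bsub>A\<^esub> k = scale (of_nat k) x" for x and k :: nat
    by (induction k) (auto simp: A_def scale_left_distrib add.commute)
  have "A.ord w dvd p"
    using wX by (subst A.pow_eq_id [symmetric]) (simp_all only: pow scale_p, simp_all add: A_def)
  moreover have "A.ord w \<noteq> 1"
    using wX w by (subst A.ord_eq_1) (auto simp: A_def)
  ultimately have "A.ord w = p"
    using p by (auto simp: prime_nat_iff)
  then have card_X: "p dvd card X"
    using A.ord_dvd_group_order[of w] wX by (simp add: A_def order_def)
  interpret X: group_action G X "\<lambda>g. restrict (\<rho> g) X"
    by (rule restrict_invariant_subset) (auto simp: X_def rho_comb)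
  have dvd: "p dvd card {x \<in> X. \<forall>g \<in> carrier G. restrict (\<rho> g) X x = x}"
    by (rule X.prime_dvd_card_fixed_points[OF p ord fin card_X])
  have "\<not> {x \<in> X. \<forall>g \<in> carrier G. restrict (\<rho> g) X x = x} \<subseteq> {0}"
  proof
    assume "{x \<in> X. \<forall>g \<in> carrier G. restrict (\<rho> g) X x = x} \<subseteq> {0}"
    then have "{x \<in> X. \<forall>g \<in> carrier G. restrict (\<rho> g) X x = x} = {0}"
      using X0 by (auto simp: rho_zero)
    with dvd p show False
      by (simp add: prime_nat_iff)
  qed
  then show ?thesis
    using XS by (fastforce simp: fixed_points_def)
qed

end

section \<open>Invariants on lines in the direction of a fixed point\<close>

text \<open>The induction on \<open>m\<close> starts at \<open>j = r + 1\<close>, where the power of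
  \<open>z\<close> is the identity and exponent \<open>p^0 = 1\<close> asserts only polynomiality.
  \<open>w\<close> is generalised because the step moves it to \<open>w + s y\<close>.\<close>

lemma invariant_on_line_in_power:
  fixes G (structure) and scale :: "'f::alg_closed_field \<Rightarrow> 'v::ab_group_add \<Rightarrow> 'v"
  assumes "G_module G scale \<rho>"
    and p: "prime p" and char: "CHAR('f) = p"
    and z: "z \<in> carrier G" "z [^]\<^bsub>G\<^esub> (p ^ Suc r) = \<one>\<^bsub>G\<^esub>"
    and v: "v = \<rho> (z [^]\<^bsub>G\<^esub> (p ^ r)) u - u" "\<rho> z v = v"
    and f: "f \<in> homogeneous_invariants G scale \<rho> d"
    and w: "\<rho> (z [^]\<^bsub>G\<^esub> (p ^ j)) w = w" and jm: "j + m = Suc r"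
  shows "\<exists>Q. \<forall>t. f (w + scale t v) = poly Q (t ^ (p ^ m))"
  using w jm
proof (induction m arbitrary: j w)
  case 0
  interpret G_module G scale \<rho> by fact
  \<comment> \<open>With second direction 0 the plane collapses to the line through
    \<open>w\<close>.\<close>
  obtain R where R: "\<And>s t. f (w + scale s 0 + scale t v) = poly (poly R [:t:]) s"
    using homogeneous_poly_on_plane[OF homogeneous_invariantsD(1)[OF f]] by blast
  have "f (w + scale t v) = poly (map_poly (\<lambda>q. poly q 0) R) (t ^ (p ^ 0))" for t
    using R[of 0 t] by (simp add: poly_poly_const)
  then show ?case by blast
next
  case (Suc m)
  interpret G_module G scale \<rho> by fact
  \<comment> \<open>\<open>(x - 1)(1 + x + \<dots> + x\<^bsup>p^m-1\<^esup>) = x\<^bsup>p^m\<^esup> - 1\<close> at \<open>x = z\<^bsup>p^j\<^esup>\<close>\<close>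
  define y where "y = (\<Sum>i<p ^ m. \<rho> (z [^] (i * p ^ j)) u)"
  have zpow: "z [^] (k::nat) \<in> carrier G" for k
    using z by simp
  have fixed_v: "\<rho> (z [^] (k::nat)) v = v" for k
    using z v(2) by (induction k) (auto simp: rho_mult)
  have "\<rho> (z [^] (p ^ j)) y - y = (\<Sum>i<p ^ m. \<rho> (z [^] (Suc i * p ^ j)) u - \<rho> (z [^] (i * p ^ j)) u)"
    unfolding y_def rho_sum[OF zpow] sum_subtractf [symmetric]
    using z by (simp add: rho_mult [symmetric] nat_pow_mult)
  also have "\<dots> = \<rho> (z [^] (p ^ m * p ^ j)) u - \<rho> (z [^] (0 * p ^ j)) u"
    by (rule sum_lessThan_telescope)
  \<comment> \<open>Since \<open>j + Suc m = Suc r\<close>, the telescoping sum ends exactly at the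
    power of \<open>z\<close> that defines \<open>v\<close>.\<close>
  also have "p ^ m * p ^ j = p ^ r"
    using Suc.prems(2) by (simp add: power_add [symmetric] add.commute)
  finally have y: "\<rho> (z [^] (p ^ j)) y = y + v"
    by (simp add: v(1) algebra_simps)
  have step: "\<rho> (z [^] (p ^ j)) (w + scale s y + scale t v) = w + scale s y + scale (t + s) v" for s t
    using Suc.prems(1) zpow
    by (simp add: rho_add rho_scale y fixed_v scale_left_distrib scale_right_distrib algebra_simps)
  \<comment> \<open>After \<open>p\<close> iterations of \<open>step\<close> the shift is
    \<open>p s v = 0\<close>, so \<open>z^(p^(j+1))\<close> fixes \<open>w + s y\<close> and the
    induction hypothesis applies to it.\<close>
  have orbit: "\<rho> (z [^] (k * p ^ j)) (w + scale s y) = w + scale s y + scale (of_nat k * s) v" for s k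
  proof (induction k)
    case (Suc k)
    have "z [^] (Suc k * p ^ j) = z [^] (p ^ j) \<otimes> z [^] (k * p ^ j)"
      using z by (simp add: nat_pow_mult)
    then have "\<rho> (z [^] (Suc k * p ^ j)) (w + scale s y) = w + scale s y + scale (of_nat k * s + s) v"
      by (simp only: rho_mult zpow Suc.IH step)
    then show ?case
      by (simp add: distrib_right add.commute)
  qed simp
  obtain R where R: "\<And>s t. f (w + scale s y + scale t v) = poly (poly R [:t:]) s"
    using homogeneous_poly_on_plane[OF homogeneous_invariantsD(1)[OF f]] by blast
  have "\<exists>Q. \<forall>t. poly (poly R [:t:]) s = poly Q (t ^ (p ^ m))" for s
    unfolding R [symmetric]
  proof (rule Suc.IH)
    show "\<rho> (z [^] (p ^ Suc j)) (w + scale s y) = w + scale s y"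
      using orbit[of p s] of_nat_CHAR[where 'a = 'f] by (simp add: char)
    show "Suc j + m = Suc r"
      using Suc.prems(2) by simp
  qed
  \<comment> \<open>Applying \<open>z^(p^j)\<close> to the argument of \<open>f\<close> realises the
    shift of \<open>t\<close> by \<open>s\<close>.\<close>
  moreover have "poly (poly R [:t + s:]) s = poly (poly R [:t:]) s" for s t
    unfolding R [symmetric] step [symmetric] by (rule homogeneous_invariantsD(2)[OF f zpow])
  ultimately have "\<exists>Q. \<forall>t. poly (poly R [:t:]) 0 = poly Q (t ^ (p ^ m * CHAR('f)))"
    using p char by (intro poly_in_power_CHAR_if_shift_invariant[where n = m]) simp_all
  then show ?case
    by (simp add: R [symmetric] char mult.commute)
qed

lemma invariant_degree_dvd:
  fixes G (structure) and scale :: "'f::alg_closed_field \<Rightarrow> 'v::ab_group_add \<Rightarrow> 'v"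
  assumes M: "G_module G scale \<rho>"
    and p: "prime p" and char: "CHAR('f) = p"
    and z: "z \<in> carrier G" "z [^]\<^bsub>G\<^esub> (p ^ Suc r) = \<one>\<^bsub>G\<^esub>"
    and v: "v = \<rho> (z [^]\<^bsub>G\<^esub> (p ^ r)) u - u" "\<rho> z v = v"
    and f: "f \<in> homogeneous_invariants G scale \<rho> d" "f v \<noteq> 0"
  shows "p ^ Suc r dvd d"
proof -
  interpret G_module G scale \<rho> by fact
  have q: "p ^ Suc r > 0" using p by (simp add: prime_gt_0_nat)
  have "\<rho> (z [^] (p ^ 0)) 0 = 0"
    using z by (simp add: rho_zero)
  then obtain Q where Q: "\<And>t. f (0 + scale t v) = poly Q (t ^ (p ^ Suc r))"
    using invariant_on_line_in_power[OF M p char z v f(1), of 0 0 "Suc r"] by auto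
  have "f (scale t v) = t ^ d * f v" for t
    by (rule homogeneous_poly_scale[OF homogeneous_invariantsD(1)[OF f(1)]])
  \<comment> \<open>On the line through 0, homogeneity leaves the single monomial
    \<open>f v * t^d\<close>; equality of values lifts to equality of polynomials over an infinite
    field.\<close>
  then have "monom (f v) d = pcompose Q (monom 1 (p ^ Suc r))"
    using Q by (intro poly_eqI_infinite infinite_UNIV_alg_closed)
      (simp add: poly_pcompose poly_monom mult.commute)
  then have "\<not> p ^ Suc r dvd d \<longrightarrow> coeff (monom (f v) d) d = 0"
    using pcompose_monom_iff[OF q, of "monom (f v) d"] by blast
  with f(2) show ?thesis by auto
qed

section \<open>The lower bound from a central element\<close>

text \<open>Faithfulness makes the image of \<open>\<rho> x - 1\<close> with
  \<open>x = z^(p^r)\<close> nonzero, and centrality makes it stable under \<open>G\<close>; a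
  nonzero fixed point in it serves as \<open>v\<close>.\<close>

lemma group_exponent_center_le_\<delta>:
  fixes G (structure) and scale :: "'f::alg_closed_field \<Rightarrow> 'v::ab_group_add \<Rightarrow> 'v"
  assumes M: "G_module G scale \<rho>" and faithful: "faithful_action G UNIV \<rho>"
    and p: "prime p" and char: "CHAR('f) = p" and ord: "order G = p ^ n"
    and z: "z \<in> center G" "group.ord G z = p ^ Suc r"
  shows "enat (p ^ Suc r) \<le> \<delta> G scale \<rho>"
proof -
  interpret G_module G scale \<rho> by fact
  have zG: "z \<in> carrier G"
    using z by (auto simp: center_def)
  define x where "x = z [^] (p ^ r)"
  have "z [^] (i::nat) \<in> center G" for i
    using z(1) by (induction i) (simp_all add: subgroup.one_closed subgroup.m_closed center_subgroup)
  then have xG: "x \<in> carrier G" and xcomm: "\<And>g. g \<in> carrier G \<Longrightarrow> x \<otimes> g = g \<otimes> x"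
    by (auto simp: x_def center_def)
  define T where "T u = \<rho> x u - u" for u
  have "\<not> p ^ Suc r dvd p ^ r"
    using prime_gt_1_nat[OF p] by (auto dest!: dvd_imp_le)
  then have "x \<noteq> \<one>"
    using zG z(2) by (simp add: x_def pow_eq_id)
  then have "\<rho> x \<noteq> \<rho> \<one>"
    using faithful xG by (auto simp: faithful_action_def faithful_action_axioms_def inj_on_def)
  then obtain u0 where "T u0 \<noteq> 0"
    by (auto simp: T_def fun_eq_iff)
  moreover have "subspace (range T)"
  proof (rule subspaceI)
    have "T 0 = 0" using xG by (simp add: T_def rho_zero)
    then show "0 \<in> range T" by (metis rangeI)
    have "T a + T b = T (a + b)" for a b
      using xG by (simp add: T_def rho_add)
    then show "a + b \<in> range T" if "a \<in> range T" "b \<in> range T" for a b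
      using that by auto
    have "scale c (T a) = T (scale c a)" for c a
      using xG by (simp add: T_def rho_scale scale_right_diff_distrib)
    then show "scale c a \<in> range T" if "a \<in> range T" for c a
      using that by auto
  qed
  moreover have "\<rho> g a \<in> range T" if "g \<in> carrier G" "a \<in> range T" for g a
  proof -
    have "\<rho> g (T b) = T (\<rho> g b)" for b
      using that(1) xG xcomm[of g] by (simp add: T_def rho_diff rho_mult [symmetric])
    with that show ?thesis by auto
  qed
  ultimately obtain v where v: "v \<in> range T" "v \<noteq> 0" "v \<in> fixed_points G \<rho>"
    using fixed_point_in_stable_subspace[OF p char ord, of "range T" "T u0"] by blast
  then obtain u where u: "v = \<rho> (z [^] (p ^ r)) u - u"
    by (auto simp: T_def x_def)
  have zv: "\<rho> z v = v"
    using v(3) zG by (simp add: fixed_points_def)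
  have zq: "z [^] (p ^ Suc r) = \<one>"
    using pow_ord_eq_1[OF zG] z(2) by simp
  have "enat (p ^ Suc r) \<le> \<epsilon> G scale \<rho> v"
    unfolding \<epsilon>_def
  proof (rule Inf_greatest)
    fix k assume "k \<in> enat ` {d. d > 0 \<and> (\<exists>f \<in> homogeneous_invariants G scale \<rho> d. f v \<noteq> 0)}"
    then obtain d f where "k = enat d" "d > 0" "f \<in> homogeneous_invariants G scale \<rho> d" "f v \<noteq> 0"
      by auto
    then show "enat (p ^ Suc r) \<le> k"
      using invariant_degree_dvd[OF M p char zG zq u zv] by (auto dest!: dvd_imp_le)
  qed
  \<comment> \<open>The nonzero fixed point \<open>v\<close> excludes the branch in which \<delta>
    is 0.\<close>
  also have "\<dots> \<le> \<delta> G scale \<rho>"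
    using v by (auto simp: \<delta>_def intro!: SUP_upper)
  finally show ?thesis .
qed

theorem theorem10:
  fixes G :: "('g, 'm) monoid_scheme"
    and scale :: "'f::alg_closed_field \<Rightarrow> 'v::ab_group_add \<Rightarrow> 'v"
    and \<rho> :: "'g \<Rightarrow> 'v \<Rightarrow> 'v"
    and p :: nat
  assumes "CHAR('f) = p" and "p > 0"
    and "finite_p_group p G" and "carrier G \<noteq> {\<one>\<^bsub>G\<^esub>}"
    and "G_module G scale \<rho>" and "faithful_action G UNIV \<rho>"
  shows "\<delta> G scale \<rho> \<ge> enat (group_exponent (G\<lparr>carrier := center G\<rparr>)) \<and>
         group_exponent (G\<lparr>carrier := center G\<rparr>) \<ge> p \<and>
         (comm_group G \<longrightarrow>
            \<delta> G scale \<rho> \<ge> enat (group_exponent G) \<and> group_exponent G \<ge> p)"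
proof -
  interpret G_module G scale \<rho> by fact
  define Z where "Z = G\<lparr>carrier := center G\<rparr>"
  have p: "prime p"
    using assms(1,2) prime_CHAR_semidom[where 'a = 'f] by simp
  obtain n where n: "order G = p ^ n"
    using assms(3) by (auto simp: finite_p_group_def)
  interpret Z: group Z
    unfolding Z_def by (rule subgroup.subgroup_is_group[OF center_subgroup is_group])
  have "card (center G) dvd p ^ n"
    using lagrange[OF center_subgroup] n by (metis dvd_triv_right)
  then obtain m where "order Z = p ^ m"
    using p by (auto simp: divides_primepow_nat Z_def order_def)
  then obtain z where z: "z \<in> carrier Z" and exp: "group_exponent Z = Z.ord z"
    and "Z.ord z dvd p ^ m"
    using Z.p_group_exponent_attained[OF p] Z.ord_dvd_group_order by metis
  then obtain k where k: "Z.ord z = p ^ k"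
    using p by (auto simp: divides_primepow_nat)
  have zc: "z \<in> center G" and zG: "z \<in> carrier G"
    using z by (auto simp: Z_def center_def)
  have pow: "x [^]\<^bsub>Z\<^esub> (i::nat) = x [^]\<^bsub>G\<^esub> i" for x i
    unfolding Z_def nat_pow_def by simp
  \<comment> \<open>Powers in \<open>Z\<close> and in \<open>G\<close> agree, so \<open>z\<close>
    has the same order in both groups.\<close>
  have ord_z: "ord z = p ^ k"
  proof -
    have "z [^]\<^bsub>G\<^esub> i = \<one>\<^bsub>G\<^esub> \<longleftrightarrow> p ^ k dvd i" for i :: nat
      using Z.pow_eq_id[OF z, of i] unfolding pow k by (simp add: Z_def)
    then show ?thesis
      using ord_unique[OF zG, of "p ^ k"] by blast
  qed
  \<comment> \<open>Exponent 1 would force a trivial center, impossible for a nontrivial p-group.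
    Hence \<open>k = r + 1\<close>, which also gives the bound by \<open>p\<close>.\<close>
  have "k \<noteq> 0"
  proof
    assume "k = 0"
    have "x = \<one>\<^bsub>G\<^esub>" if "x \<in> center G" for x
    proof -
      have x: "x \<in> carrier Z"
        using that by (simp add: Z_def)
      have "Z.ord x dvd group_exponent Z"
        unfolding group_exponent_def using x by (intro dvd_Lcm) simp
      then have "Z.ord x = 1"
        using exp k \<open>k = 0\<close> by simp
      then show ?thesis
        using Z.ord_eq_1[OF x] by (simp add: Z_def)
    qed
    then have "center G = {\<one>\<^bsub>G\<^esub>}"
      using subgroup.one_closed[OF center_subgroup] by blast
    then show False
      using p_group_center_nontrivial[OF p n assms(4)] by contradiction
  qed
  then obtain r where r: "k = Suc r"
    by (cases k) auto
  have bound: "enat (group_exponent Z) \<le> \<delta> G scale \<rho>"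
    using group_exponent_center_le_\<delta>[OF assms(5,6) p assms(1) n zc, of r] ord_z exp k r by simp
  have ge: "p \<le> group_exponent Z"
    using exp k r prime_gt_0_nat[OF p] by simp
  \<comment> \<open>For abelian \<open>G\<close> the record update replaces the carrier by itself,
    so the bounds for \<open>Z\<close> are already those for \<open>G\<close>.\<close>
  have "Z = G" if "comm_group G"
  proof -
    have "center G = carrier G"
      using comm_groupE(4)[OF that] by (auto simp: center_def)
    then show ?thesis by (simp add: Z_def)
  qed
  with bound ge show ?thesis
    by (auto simp: Z_def)
qed

end
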